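(* Let $M$ be a positive integer and let $f:K^-_{[0,1]}\to\mathbb{C}$ be a function. Then each of the following four functions interpolates $f$ on the indicated grid. (AMDCT-I) With $x_m=\frac{m}{M}$, $y_n=\frac{n}{M}$, the function $$\psi^{\mathrm{I},-}_M(x,y)=\sum_{\substack{k,l=0 \\ k>l}}^{M}c^{\mathrm{I},-}_{k,l}\cos^-_{(k,l)}(x,y),\qquad c^{\mathrm{I},-}_{k,l}=\frac{4d_{k,M}d_{l,M}}{M^2}\sum_{\substack{m,n=0 \\ m>n}}^{M}d_{m,M}d_{n,M}f(x_m,y_n)\cos^-_{(k,l)}(x_m,y_n)$$ satisfies $\psi^{\mathrm{I},-}_M(x_m,y_n)=f(x_m,y_n)$ for all $m,n\in\{0,\dots,M\}$, $m>n$. (AMDCT-II) With $x_m=\frac{m+1/2}{M}$, $y_n=\frac{n+1/2}{M}$, the function $$\psi^{\mathrm{II},-}_M(x,y)=\sum_{\substack{k,l=0 \\ k>l}}^{M-1}c^{\mathrm{II},-}_{k,l}\cos^-_{(k,l)}(x,y),\qquad c^{\mathrm{II},-}_{k,l}=\frac{4d_{k,M}d_{l,M}}{M^2}\sum_{\substack{m,n=0 \\ m>n}}^{M-1}f(x_m,y_n)\cos^-_{(k,l)}(x_m,y_n)$$ satisfies $\psi^{\mathrm{II},-}_M(x_m,y_n)=f(x_m,y_n)$ for all $m,n\in\{0,\dots,M-1\}$, $m>n$. (AMDCT-III) With $x_m=\frac{m}{M}$, $y_n=\frac{n}{M}$, the function $$\psi^{\mathrm{III},-}_M(x,y)=\sum_{\substack{k,l=0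 \\ k>l}}^{M-1}c^{\mathrm{III},-}_{k,l}\cos^-_{(k+\frac12,l+\frac12)}(x,y),\qquad c^{\mathrm{III},-}_{k,l}=\frac{4}{M^2}\sum_{\substack{m,n=0 \\ m>n}}^{M-1}d_{m,M}d_{n,M}f(x_m,y_n)\cos^-_{(k+\frac12,l+\frac12)}(x_m,y_n)$$ satisfies $\psi^{\mathrm{III},-}_M(x_m,y_n)=f(x_m,y_n)$ for all $m,n\in\{0,\dots,M-1\}$, $m>n$. (AMDCT-IV) With $x_m=\frac{m+1/2}{M}$, $y_n=\frac{n+1/2}{M}$, the function $$\psi^{\mathrm{IV},-}_M(x,y)=\sum_{\substack{k,l=0 \\ k>l}}^{M-1}c^{\mathrm{IV},-}_{k,l}\cos^-_{(k+\frac12,l+\frac12)}(x,y),\qquad c^{\mathrm{IV},-}_{k,l}=\frac{4}{M^2}\sum_{\substack{m,n=0 \\ m>n}}^{M-1}f(x_m,y_n)\cos^-_{(k+\frac12,l+\frac12)}(x_m,y_n)$$ satisfies $\psi^{\mathrm{IV},-}_M(x_m,y_n)=f(x_m,y_n)$ for all $m,n\in\{0,\dots,M-1\}$, $m>n$.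
   Context: For $\lambda,\mu,x,y\in\mathbb{R}$, the antisymmetric cosine function is $\cos^-_{(\lambda,\mu)}(x,y)=\cos(\pi\lambda x)\cos(\pi\mu y)-\cos(\pi\mu x)\cos(\pi\lambda y)$. The triangle is $K^-_{[0,1]}=\{(x,y)\in[0,1]\times[0,1] : x>y\}$. For $k\in\{0,\dots,M\}$, $d_{k,M}=\tfrac12$ if $k=0$ or $k=M$, and $d_{k,M}=1$ otherwise. *)

theory Defs
  imports Complex_Main "HOL-Library.FuncSet"
begin

definition cos_minus :: "real \<times> real \<Rightarrow> real \<times> real \<Rightarrow> real"
  where "cos_minus = (\<lambda>(lam, mu) (x, y).
    cos (pi * lam * x) * cos (pi * mu * y) - cos (pi * mu * x) * cos (pi * lam * y))"

definition K_minus :: "(real \<times> real) set"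
  where "K_minus = {(x, y). x \<in> {0..1} \<and> y \<in> {0..1} \<and> x > y}"

definition dwt :: "nat \<Rightarrow> nat \<Rightarrow> real"
  where "dwt k M = (if k = 0 \<or> k = M then 1/2 else 1)"

definition strict_pairs :: "nat \<Rightarrow> (nat \<times> nat) set"
  where "strict_pairs N = {(k, l). k \<in> {0..N} \<and> l \<in> {0..N} \<and> k > l}"

definition node :: "nat \<Rightarrow> nat \<Rightarrow> real"
  where "node M m = real m / real M"

definition mid_node :: "nat \<Rightarrow> nat \<Rightarrow> real"
  where "mid_node M m = (real m + 1/2) / real M"

definition c_I :: "nat \<Rightarrow> (real \<times> real \<Rightarrow> complex) \<Rightarrow> nat \<Rightarrow> nat \<Rightarrow> complex"
  where "c_I M f k l = of_real (4 * dwt k M * dwt l M / (real M)^2) *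
    (\<Sum>(m, n) \<in> strict_pairs M. of_real (dwt m M * dwt n M) * f (node M m, node M n) *
       of_real (cos_minus (real k, real l) (node M m, node M n)))"

definition psi_I :: "nat \<Rightarrow> (real \<times> real \<Rightarrow> complex) \<Rightarrow> real \<times> real \<Rightarrow> complex"
  where "psi_I M f p =
    (\<Sum>(k, l) \<in> strict_pairs M. c_I M f k l * of_real (cos_minus (real k, real l) p))"

definition c_II :: "nat \<Rightarrow> (real \<times> real \<Rightarrow> complex) \<Rightarrow> nat \<Rightarrow> nat \<Rightarrow> complex"
  where "c_II M f k l = of_real (4 * dwt k M * dwt l M / (real M)^2) *
    (\<Sum>(m, n) \<in> strict_pairs (M - 1). f (mid_node M m, mid_node M n) *
       of_real (cos_minus (real k, real l) (mid_node M m, mid_node M n)))"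

definition psi_II :: "nat \<Rightarrow> (real \<times> real \<Rightarrow> complex) \<Rightarrow> real \<times> real \<Rightarrow> complex"
  where "psi_II M f p =
    (\<Sum>(k, l) \<in> strict_pairs (M - 1). c_II M f k l * of_real (cos_minus (real k, real l) p))"

definition c_III :: "nat \<Rightarrow> (real \<times> real \<Rightarrow> complex) \<Rightarrow> nat \<Rightarrow> nat \<Rightarrow> complex"
  where "c_III M f k l = of_real (4 / (real M)^2) *
    (\<Sum>(m, n) \<in> strict_pairs (M - 1). of_real (dwt m M * dwt n M) * f (node M m, node M n) *
       of_real (cos_minus (real k + 1/2, real l + 1/2) (node M m, node M n)))"

definition psi_III :: "nat \<Rightarrow> (real \<times> real \<Rightarrow> complex) \<Rightarrow> real \<times> real \<Rightarrow> complex"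
  where "psi_III M f p =
    (\<Sum>(k, l) \<in> strict_pairs (M - 1).
       c_III M f k l * of_real (cos_minus (real k + 1/2, real l + 1/2) p))"

definition c_IV :: "nat \<Rightarrow> (real \<times> real \<Rightarrow> complex) \<Rightarrow> nat \<Rightarrow> nat \<Rightarrow> complex"
  where "c_IV M f k l = of_real (4 / (real M)^2) *
    (\<Sum>(m, n) \<in> strict_pairs (M - 1). f (mid_node M m, mid_node M n) *
       of_real (cos_minus (real k + 1/2, real l + 1/2) (mid_node M m, mid_node M n)))"

definition psi_IV :: "nat \<Rightarrow> (real \<times> real \<Rightarrow> complex) \<Rightarrow> real \<times> real \<Rightarrow> complex"
  where "psi_IV M f p =
    (\<Sum>(k, l) \<in> strict_pairs (M - 1).
       c_IV M f k l * of_real (cos_minus (real k + 1/2, real l + 1/2) p))"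

text \<open>Every grid point lies in the triangle, so only values of f on its domain are used.\<close>

lemma node_in_K_minus:
  assumes "M > 0" "(m, n) \<in> strict_pairs M"
  shows "(node M m, node M n) \<in> K_minus"
  using assms by (auto simp: strict_pairs_def K_minus_def node_def divide_simps)

lemma mid_node_in_K_minus:
  assumes "M > 0" "(m, n) \<in> strict_pairs (M - 1)"
  shows "(mid_node M m, mid_node M n) \<in> K_minus"
proof -
  have "n < m" "m + 1 \<le> M"
    using assms by (auto simp: strict_pairs_def)
  then have "real n < real m" "real m + 1 \<le> real M"
    by linarith+
  then show ?thesis
    using assms(1) by (auto simp: K_minus_def mid_node_def divide_simps)
qed

end

theory Submission
  imports Defs
begin

text \<open>
  On the grid, each one-dimensional discrete cosine transform has an orthogonal kernel matrix, so the
  weighted sums over frequencies of products of two cosines at nodes \<open>m\<close>, \<open>m'\<close> vanish unless \<open>m = m'\<close>.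
  The antisymmetric functions are \<open>2 \<times> 2\<close> minors of this matrix, and the sum over \<open>k > l\<close> of
  products of two minors is, by Cauchy-Binet, the corresponding minor of the identity matrix.
\<close>

section \<open>Triangular sums and products of minors\<close>

lemma finite_strict_pairs [simp]: "finite (strict_pairs N)"
  by (rule finite_subset[of _ "{..N} \<times> {..N}"]) (auto simp: strict_pairs_def)

text \<open>The square is the union of the triangle, its mirror image and the diagonal; by symmetry
  the two triangles contribute equally. This trades a triangular sum for a double sum that can
  factor.\<close>

lemma sum_strict_pairs_symmetric:
  fixes g :: "nat \<Rightarrow> nat \<Rightarrow> real"
  assumes sym: "\<And>k l. g k l = g l k" and diag: "\<And>k. g k k = 0"
  shows "2 * (\<Sum>(k, l)\<in>strict_pairs N. g k l) = (\<Sum>k\<le>N. \<Sum>l\<le>N. g k l)"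
proof -
  let ?L = "strict_pairs N"
  have split: "{..N} \<times> {..N} = (?L \<union> prod.swap ` ?L) \<union> (\<lambda>k. (k, k)) ` {..N}"
  proof (rule set_eqI)
    fix p :: "nat \<times> nat"
    obtain k l where p: "p = (k, l)" by (cases p)
    have "(k, l) \<in> prod.swap ` ?L \<longleftrightarrow> (l, k) \<in> ?L"
      by force
    then show "p \<in> {..N} \<times> {..N} \<longleftrightarrow> p \<in> (?L \<union> prod.swap ` ?L) \<union> (\<lambda>k. (k, k)) ` {..N}"
      unfolding p by (auto simp: strict_pairs_def)
  qed
  have "(\<Sum>k\<le>N. \<Sum>l\<le>N. g k l) = (\<Sum>(k, l)\<in>{..N} \<times> {..N}. g k l)"
    by (simp add: sum.cartesian_product)
  also have "\<dots> = (\<Sum>(k, l)\<in>?L \<union> prod.swap ` ?L. g k l) + (\<Sum>(k, l)\<in>(\<lambda>k. (k, k)) ` {..N}. g k l)"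
    unfolding split by (rule sum.union_disjoint, simp, simp, auto simp: strict_pairs_def)
  also have "(\<Sum>(k, l)\<in>(\<lambda>k. (k, k)) ` {..N}. g k l) = 0"
    by (rule sum.neutral) (auto simp: diag)
  also have "(\<Sum>(k, l)\<in>?L \<union> prod.swap ` ?L. g k l)
      = (\<Sum>(k, l)\<in>?L. g k l) + (\<Sum>(k, l)\<in>prod.swap ` ?L. g k l)"
    by (rule sum.union_disjoint, simp, simp, auto simp: strict_pairs_def)
  also have "(\<Sum>(k, l)\<in>prod.swap ` ?L. g k l) = (\<Sum>(k, l)\<in>?L. g k l)"
    by (subst sum.reindex) (auto simp: sym case_prod_beta intro!: sum.cong)
  finally show ?thesis by simp
qed

text \<open>Weighted Cauchy-Binet for two rows. Each minor changes sign when \<open>k\<close> and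
  \<open>l\<close> are exchanged, so their product is symmetric and zero on the diagonal; over the
  full square the expansion yields four factoring double sums, equal in pairs.\<close>

lemma sum_minor_products:
  fixes w :: "nat \<Rightarrow> real"
  shows "(\<Sum>(k, l)\<in>strict_pairs N.
            w k * w l * (a k * b l - a l * b k) * (p k * q l - p l * q k)) =
         (\<Sum>k\<le>N. w k * a k * p k) * (\<Sum>k\<le>N. w k * b k * q k) -
         (\<Sum>k\<le>N. w k * a k * q k) * (\<Sum>k\<le>N. w k * b k * p k)"
    (is "?lhs = ?A * ?D - ?B * ?C")
proof -
  have "2 * ?lhs = (\<Sum>k\<le>N. \<Sum>l\<le>N.
            w k * w l * (a k * b l - a l * b k) * (p k * q l - p l * q k))"
    by (rule sum_strict_pairs_symmetric) (auto simp: algebra_simps)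
  also have "\<dots> = (\<Sum>k\<le>N. \<Sum>l\<le>N. (w k * a k * p k) * (w l * b l * q l)
       - (w k * a k * q k) * (w l * b l * p l) - (w k * b k * p k) * (w l * a l * q l)
       + (w k * b k * q k) * (w l * a l * p l))"
    by (intro sum.cong refl) (simp add: algebra_simps)
  also have "\<dots> = ?A * ?D - ?B * ?C - ?C * ?B + ?D * ?A"
    by (simp add: sum.distrib sum_subtractf sum_product)
  finally show ?thesis by simp
qed

section \<open>From one-dimensional orthogonality to interpolation on the triangle\<close>

text \<open>The common core of the four transforms: \<open>u\<close> weights the nodes,
  \<open>w\<close> the frequencies, and \<open>c\<close> normalizes one dimension. After exchanging
  the two sums, the coefficient of \<open>F m' n'\<close> is a 2 by 2 minor of the identity
  matrix.\<close>

lemma antisymmetric_interpolation: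
  fixes \<phi> :: "nat \<Rightarrow> nat \<Rightarrow> real" and F :: "nat \<Rightarrow> nat \<Rightarrow> complex"
  assumes orth: "\<And>m m'. m \<le> N \<Longrightarrow> m' \<le> N \<Longrightarrow>
      c * u m' * (\<Sum>k\<le>N. w k * \<phi> k m * \<phi> k m') = (if m = m' then 1 else 0)"
    and mn: "(m, n) \<in> strict_pairs N"
  defines "D \<equiv> \<lambda>k l m n. \<phi> k m * \<phi> l n - \<phi> l m * \<phi> k n"
  shows "(\<Sum>(k, l)\<in>strict_pairs N. of_real (c\<^sup>2 * (w k * w l)) *
       (\<Sum>(m', n')\<in>strict_pairs N. of_real (u m' * u n') * F m' n' * of_real (D k l m' n'))
       * of_real (D k l m n)) = F m n"
proof -
  define S where "S = (\<lambda>m m'. \<Sum>k\<le>N. w k * \<phi> k m * \<phi> k m')"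
  have kernel: "c\<^sup>2 * (u m' * u n') *
      (\<Sum>(k, l)\<in>strict_pairs N. w k * w l * D k l m n * D k l m' n') =
      (if (m', n') = (m, n) then 1 else 0)"
    if "(m', n') \<in> strict_pairs N" for m' n'
  proof -
    have le: "m \<le> N" "n \<le> N" "n < m" "m' \<le> N" "n' \<le> N" "n' < m'"
      using mn that by (auto simp: strict_pairs_def)
    have minors: "(\<Sum>(k, l)\<in>strict_pairs N. w k * w l * D k l m n * D k l m' n')
        = S m m' * S n n' - S m n' * S n m'"
      unfolding D_def S_def
      by (rule sum_minor_products)
    have "c\<^sup>2 * (u m' * u n') *
        (\<Sum>(k, l)\<in>strict_pairs N. w k * w l * D k l m n * D k l m' n')
        = (c * u m' * S m m') * (c * u n' * S n n') - (c * u n' * S m n') * (c * u m' * S n m')"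
      unfolding minors by (simp add: algebra_simps power2_eq_square)
    \<comment> \<open>The second product would need \<open>m = n'\<close> and \<open>n = m'\<close>,
      which contradicts \<open>n < m\<close> and \<open>n' < m'\<close>; only the first
      survives.\<close>
    also have "\<dots> = (if (m', n') = (m, n) then 1 else 0)"
      using le by (simp add: S_def orth)
    finally show ?thesis .
  qed
  have "(\<Sum>(k, l)\<in>strict_pairs N. of_real (c\<^sup>2 * (w k * w l)) *
       (\<Sum>(m', n')\<in>strict_pairs N. of_real (u m' * u n') * F m' n' * of_real (D k l m' n'))
       * of_real (D k l m n))
    = (\<Sum>(k, l)\<in>strict_pairs N. \<Sum>(m', n')\<in>strict_pairs N.
        F m' n' * of_real (c\<^sup>2 * (u m' * u n') * (w k * w l * D k l m n * D k l m' n')))"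
    by (intro sum.cong refl)
       (auto simp: sum_distrib_left sum_distrib_right case_prod_beta mult_ac intro!: sum.cong)
  also have "\<dots> = (\<Sum>(m', n')\<in>strict_pairs N. \<Sum>(k, l)\<in>strict_pairs N.
        F m' n' * of_real (c\<^sup>2 * (u m' * u n') * (w k * w l * D k l m n * D k l m' n')))"
    unfolding case_prod_beta by (rule sum.swap)
  also have "\<dots> = (\<Sum>(m', n')\<in>strict_pairs N. F m' n' * of_real (c\<^sup>2 * (u m' * u n') *
        (\<Sum>(k, l)\<in>strict_pairs N. w k * w l * D k l m n * D k l m' n')))"
    by (simp add: sum_distrib_left case_prod_beta)
  also have "\<dots> = (\<Sum>q\<in>strict_pairs N. if q = (m, n) then F m n else 0)"
  proof (rule sum.cong[OF refl])
    fix q assume q: "q \<in> strict_pairs N"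
    obtain m' n' where [simp]: "q = (m', n')" by (cases q)
    have "(m', n') \<in> strict_pairs N" using q by simp
    then show "(case q of (m', n') \<Rightarrow> F m' n' * of_real (c\<^sup>2 * (u m' * u n') *
        (\<Sum>(k, l)\<in>strict_pairs N. w k * w l * D k l m n * D k l m' n'))) =
        (if q = (m, n) then F m n else 0)"
      unfolding \<open>q = (m', n')\<close> prod.case by (subst kernel) auto
  qed
  also have "\<dots> = F m n"
    using mn by simp
  finally show ?thesis .
qed

section \<open>Finite cosine sums\<close>

text \<open>Telescoping: 2 sin(t/2) cos((k + 1/2) t) = sin((k + 1) t) - sin(k t).\<close>

lemma sin_half_mult_sum_cos:
  "2 * sin (t / 2) * (\<Sum>k<n. cos ((real k + 1/2) * t)) = sin (real n * t)"
proof (induction n)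
  case (Suc n)
  let ?x = "(real n + 1/2) * t"
  have "real (Suc n) * t = ?x + t / 2" "real n * t = ?x - t / 2"
    by (simp_all add: algebra_simps)
  then have "sin (real (Suc n) * t) = sin (real n * t) + 2 * sin (t / 2) * cos ?x"
    by (simp only: sin_add sin_diff) simp
  then show ?case
    by (simp only: sum.lessThan_Suc distrib_left Suc)
qed simp

text \<open>At t = pi j / M the telescoped value sin(M t) = sin(pi j) is zero, while the factor
  sin(t/2) vanishes only for multiples \<open>j\<close> of 2M.\<close>

lemma sum_cos_half_eq_0:
  assumes "M > 0" and "\<not> 2 * int M dvd j"
  shows "(\<Sum>k<M. cos ((real k + 1/2) * (pi * of_int j / real M))) = 0"
proof -
  let ?t = "pi * of_int j / real M"
  have "sin (?t / 2) \<noteq> 0"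
  proof
    assume "sin (?t / 2) = 0"
    then obtain i :: int where "?t / 2 = of_int i * pi"
      by (auto simp: sin_zero_iff_int2)
    then have "real_of_int j = of_int (2 * int M * i)"
      using assms(1) by (simp add: field_simps)
    then have "j = 2 * int M * i" by linarith
    with assms(2) show False by simp
  qed
  moreover have "sin (real M * ?t) = 0"
    using assms(1) by (simp add: sin_zero_iff_int2 mult.commute)
  ultimately show ?thesis
    using sin_half_mult_sum_cos[of ?t M] by simp
qed

text \<open>The trapezoidal rule: halved endpoints amount to averaging neighbouring values, which
  leads to the half-integer sums above.\<close>

lemma sum_dwt:
  assumes "M > 0"
  shows "(\<Sum>k\<le>M. dwt k M * g k) = (\<Sum>k<M. (g k + g (Suc k)) / 2)"
proof -
  obtain N where M: "M = Suc N" using assms by (cases M) auto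
  have "(\<Sum>k\<le>M. h k) = h 0 + (\<Sum>k<N. h (Suc k)) + h M" for h :: "nat \<Rightarrow> real"
    unfolding M by (induction N) auto
  then have "(\<Sum>k\<le>M. dwt k M * g k) = g 0 / 2 + (\<Sum>k<N. g (Suc k)) + g M / 2"
    by (simp add: dwt_def M)
  \<comment> \<open>The sum is the mean of two sums, one dropping the last endpoint and one the
    first.\<close>
  also have "\<dots> = ((g 0 + (\<Sum>k<N. g (Suc k))) + ((\<Sum>k<N. g (Suc k)) + g M)) / 2"
    by simp
  also have "\<dots> = ((\<Sum>k<M. g k) + (\<Sum>k<M. g (Suc k))) / 2"
    unfolding M by (subst sum.lessThan_Suc_shift) simp
  finally show ?thesis
    by (simp add: sum.distrib sum_divide_distrib add_divide_distrib)
qed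

text \<open>If 2M divides \<open>j\<close>, all cosines are 1 and the weights total M. Otherwise,
  averaging neighbours gives cos(t/2) times a cosine at the midpoint k + 1/2, and the half-integer
  sum vanishes.\<close>

lemma sum_dwt_cos:
  assumes "M > 0"
  shows "(\<Sum>k\<le>M. dwt k M * cos (real k * (pi * of_int j / real M))) =
    (if 2 * int M dvd j then real M else 0)"
proof (cases "2 * int M dvd j")
  case True
  then obtain i where j: "j = 2 * int M * i" by blast
  have "cos (real k * (pi * of_int j / real M)) = 1" for k
    using assms cos_int_2pin[of "int k * i"] by (simp add: j mult_ac)
  then show ?thesis
    using True assms by (simp add: sum_dwt[where g = "\<lambda>_. 1", simplified])
next
  case False
  let ?t = "pi * of_int j / real M"
  have "(\<Sum>k\<le>M. dwt k M * cos (real k * ?t)) =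
      (\<Sum>k<M. (cos (real k * ?t) + cos (real (Suc k) * ?t)) / 2)"
    by (rule sum_dwt[OF assms])
  also have "\<dots> = (\<Sum>k<M. cos (?t / 2) * cos ((real k + 1/2) * ?t))"
  proof (rule sum.cong[OF refl])
    fix k
    have "real k * ?t = (real k + 1/2) * ?t - ?t / 2"
      and "real (Suc k) * ?t = (real k + 1/2) * ?t + ?t / 2"
      by (simp_all add: algebra_simps add_divide_distrib)
    then show "(cos (real k * ?t) + cos (real (Suc k) * ?t)) / 2 = cos (?t / 2) * cos ((real k + 1/2) * ?t)"
      by (simp only: cos_add cos_diff)  simp
  qed
  also have "\<dots> = 0"
    using sum_cos_half_eq_0[OF assms False] by (simp flip: sum_distrib_left)
  finally show ?thesis using False by simp
qed

text \<open>Product-to-sum reduces orthogonality to single cosine sums at the difference and the sum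
  of the angles; \<open>h\<close> covers integer and half-integer frequencies alike.\<close>

lemma sum_cos_cos:
  fixes w h :: "nat \<Rightarrow> real"
  shows "(\<Sum>k\<in>A. w k * cos (h k * x) * cos (h k * y)) =
    ((\<Sum>k\<in>A. w k * cos (h k * (x - y))) + (\<Sum>k\<in>A. w k * cos (h k * (x + y)))) / 2"
  unfolding sum.distrib[symmetric] sum_divide_distrib
  by (intro sum.cong refl)
     (simp only: mult.assoc cos_times_cos right_diff_distrib distrib_left times_divide_eq_right)

lemma dvd_iff_eq_0_of_abs_less:
  fixes a b :: int
  assumes "\<bar>b\<bar> < a"
  shows "a dvd b \<longleftrightarrow> b = 0"
  using assms dvd_imp_le_int[of b a] by auto

section \<open>Orthogonality of the four cosine kernels\<close>

text \<open>For m = m' the difference term gives M/2. At the nodes 0 and M the sum term adds another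
  M/2, and the node weight 1/2 compensates for the doubling.\<close>

lemma orthogonality_I:
  assumes "M > 0" "m \<le> M" "m' \<le> M"
  shows "2 / real M * dwt m' M *
    (\<Sum>k\<le>M. dwt k M * cos (real k * (pi * node M m)) * cos (real k * (pi * node M m'))) =
    (if m = m' then 1 else 0)"
proof -
  have minus: "pi * node M m - pi * node M m' = pi * of_int (int m - int m') / real M"
    and plus: "pi * node M m + pi * node M m' = pi * of_int (int m + int m') / real M"
    by (simp_all add: node_def algebra_simps add_divide_distrib diff_divide_distrib)
  have "2 * int M dvd int m - int m' \<longleftrightarrow> m = m'"
    using dvd_iff_eq_0_of_abs_less[of "int m - int m'" "2 * int M"] assms by auto
  \<comment> \<open>Here m + m' can reach 2M, outside the strict bound, so the extreme values 0 and
    2M are treated separately.\<close>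
  moreover have "2 * int M dvd int m + int m' \<longleftrightarrow> m = m' \<and> (m' = 0 \<or> m' = M)"
  proof (cases "m + m' = 0 \<or> m + m' = 2 * M")
    case True
    then have "int m + int m' = 0 \<or> int m + int m' = 2 * int M" by linarith
    with True assms show ?thesis by auto
  next
    case False
    then show ?thesis
      using dvd_iff_eq_0_of_abs_less[of "int m + int m'" "2 * int M"] assms by auto
  qed
  ultimately show ?thesis
    using assms(1) unfolding sum_cos_cos minus plus sum_dwt_cos[OF assms(1)]
    by (auto simp: dwt_def)
qed

text \<open>Completing the frequencies to k = M makes the endpoint-weighted sum applicable. Since 0
  < m + m' + 1 < 2M, the sum term vanishes and every diagonal value is M/2.\<close>

lemma orthogonality_II:
  assumes "M > 0" "m \<le> M - 1" "m' \<le> M - 1"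
  shows "2 / real M *
    (\<Sum>k\<le>M - 1. dwt k M * cos (real k * (pi * mid_node M m)) * cos (real k * (pi * mid_node M m'))) =
    (if m = m' then 1 else 0)"
proof -
  have minus: "pi * mid_node M m - pi * mid_node M m' = pi * of_int (int m - int m') / real M"
    and plus: "pi * mid_node M m + pi * mid_node M m' = pi * of_int (int m + int m' + 1) / real M"
    by (simp_all add: mid_node_def algebra_simps add_divide_distrib diff_divide_distrib)
  have "real M * (pi * mid_node M m) = real m * pi + pi / 2"
    using assms(1) by (simp add: mid_node_def field_simps)
  then have "cos (real M * (pi * mid_node M m)) = 0" \<comment> \<open>so a term \<open>k = M\<close> may be added freely\<close>
    by (simp add: cos_add)
  then have extend: "(\<Sum>k\<le>M - 1. dwt k M * cos (real k * (pi * mid_node M m)) * cos (real k * (pi * mid_node M m')))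
      = (\<Sum>k\<le>M. dwt k M * cos (real k * (pi * mid_node M m)) * cos (real k * (pi * mid_node M m')))"
    using assms(1) by (cases M) auto
  have "2 * int M dvd int m - int m' \<longleftrightarrow> m = m'"
    using dvd_iff_eq_0_of_abs_less[of "int m - int m'" "2 * int M"] assms by auto
  moreover have "\<not> 2 * int M dvd int m + int m' + 1"
    using assms by (subst dvd_iff_eq_0_of_abs_less) auto
  ultimately show ?thesis
    using assms(1) unfolding extend unfolding sum_cos_cos minus plus sum_dwt_cos[OF assms(1)] by auto
qed

text \<open>Within the bound, 0 is the only multiple of 2M, and there each of the M terms is
  1.\<close>

lemma sum_cos_half:
  assumes "M > 0" "\<bar>j\<bar> < 2 * int M"
  shows "(\<Sum>k\<le>M - 1. cos ((real k + 1/2) * (pi * of_int j / real M))) =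
    (if j = 0 then real M else 0)"
proof -
  have "{..M - 1} = {..<M}" using assms(1) by auto
  then show ?thesis
    using sum_cos_half_eq_0[OF assms(1), of j] dvd_iff_eq_0_of_abs_less[OF assms(2)] by simp
qed

text \<open>Node M, where all these half-integer cosines vanish, is excluded, so m + m' < 2M. The
  sum term survives only at m = m' = 0, where \<open>dwt\<close> halves the doubled diagonal
  value.\<close>

lemma orthogonality_III:
  assumes "M > 0" "m \<le> M - 1" "m' \<le> M - 1"
  shows "2 / real M * dwt m' M *
    (\<Sum>k\<le>M - 1. cos ((real k + 1/2) * (pi * node M m)) * cos ((real k + 1/2) * (pi * node M m'))) =
    (if m = m' then 1 else 0)"
proof -
  have minus: "pi * node M m - pi * node M m' = pi * of_int (int m - int m') / real M"
    and plus: "pi * node M m + pi * node M m' = pi * of_int (int m + int m') / real M"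
    by (simp_all add: node_def algebra_simps add_divide_distrib diff_divide_distrib)
  have bounds: "\<bar>int m - int m'\<bar> < 2 * int M" "\<bar>int m + int m'\<bar> < 2 * int M"
    using assms by auto
  have "(\<Sum>k\<le>M - 1. cos ((real k + 1/2) * (pi * node M m)) * cos ((real k + 1/2) * (pi * node M m'))) =
      ((if int m - int m' = 0 then real M else 0) + (if int m + int m' = 0 then real M else 0)) / 2"
    using sum_cos_cos[of "\<lambda>_. 1" "\<lambda>k. real k + 1/2" "pi * node M m" "pi * node M m'" "{..M - 1}"]
    unfolding mult_1_left minus plus bounds[THEN sum_cos_half[OF assms(1)]] .
  then show ?thesis
    using assms by (auto simp: dwt_def)
qed

text \<open>As m + m' + 1 lies strictly between 0 and 2M, the sum term is always zero and the
  diagonal is constantly M/2.\<close>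

lemma orthogonality_IV:
  assumes "M > 0" "m \<le> M - 1" "m' \<le> M - 1"
  shows "2 / real M *
    (\<Sum>k\<le>M - 1. cos ((real k + 1/2) * (pi * mid_node M m)) * cos ((real k + 1/2) * (pi * mid_node M m'))) =
    (if m = m' then 1 else 0)"
proof -
  have minus: "pi * mid_node M m - pi * mid_node M m' = pi * of_int (int m - int m') / real M"
    and plus: "pi * mid_node M m + pi * mid_node M m' = pi * of_int (int m + int m' + 1) / real M"
    by (simp_all add: mid_node_def algebra_simps add_divide_distrib diff_divide_distrib)
  have bounds: "\<bar>int m - int m'\<bar> < 2 * int M" "\<bar>int m + int m' + 1\<bar> < 2 * int M"
    using assms by auto
  have "(\<Sum>k\<le>M - 1. cos ((real k + 1/2) * (pi * mid_node M m)) * cos ((real k + 1/2) * (pi * mid_node M m'))) =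
      ((if int m - int m' = 0 then real M else 0) + (if int m + int m' + 1 = 0 then real M else 0)) / 2"
    using sum_cos_cos[of "\<lambda>_. 1" "\<lambda>k. real k + 1/2" "pi * mid_node M m" "pi * mid_node M m'" "{..M - 1}"]
    unfolding mult_1_left minus plus bounds[THEN sum_cos_half[OF assms(1)]] .
  then show ?thesis
    using assms by (auto)
qed

section \<open>The four interpolation formulas\<close>

theorem mainTheorem5:
  fixes M :: nat and f :: "real \<times> real \<Rightarrow> complex"
  assumes "M > 0" and "f \<in> K_minus \<rightarrow>\<^sub>E UNIV"
  shows "(\<forall>(m, n) \<in> strict_pairs M.
            psi_I M f (node M m, node M n) = f (node M m, node M n)) \<and>
         (\<forall>(m, n) \<in> strict_pairs (M - 1).
            psi_II M f (mid_node M m, mid_node M n) = f (mid_node M m, mid_node M n)) \<and>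
         (\<forall>(m, n) \<in> strict_pairs (M - 1).
            psi_III M f (node M m, node M n) = f (node M m, node M n)) \<and>
         (\<forall>(m, n) \<in> strict_pairs (M - 1).
            psi_IV M f (mid_node M m, mid_node M n) = f (mid_node M m, mid_node M n))"
proof -
  \<comment> \<open>Regrouping the arguments exhibits \<open>cos_minus\<close> as the minor
    \<open>D\<close> of the kernel \<open>\<phi>\<close>.\<close>
  have cos_minus_eq: "cos_minus (a, b) (x, y) =
      cos (a * (pi * x)) * cos (b * (pi * y)) - cos (b * (pi * x)) * cos (a * (pi * y))" for a b x y
    by (simp add: cos_minus_def mult_ac)
  have "psi_I M f (node M m, node M n) = f (node M m, node M n)"
    if "(m, n) \<in> strict_pairs M" for m n
    \<comment> \<open>The square of \<open>c\<close> is the prefactor 4/M^2; in type I both nodes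
      and frequencies carry \<open>dwt\<close>.\<close>
    using antisymmetric_interpolation[where N = M and c = "2 / real M" and u = "\<lambda>m. dwt m M"
        and w = "\<lambda>k. dwt k M" and \<phi> = "\<lambda>k m. cos (real k * (pi * node M m))"
        and F = "\<lambda>m n. f (node M m, node M n)", OF orthogonality_I[OF assms(1)] that]
    by (simp add: psi_I_def c_I_def cos_minus_eq power_divide mult.assoc)
  moreover have "psi_II M f (mid_node M m, mid_node M n) = f (mid_node M m, mid_node M n)"
    if "(m, n) \<in> strict_pairs (M - 1)" for m n
    \<comment> \<open>Type II weights only the frequencies; simplification removes the unit factors
      so that the orthogonality relation matches.\<close>
    using antisymmetric_interpolation[where N = "M - 1" and c = "2 / real M" and u = "\<lambda>_. 1"
        and w = "\<lambda>k. dwt k M" and \<phi> = "\<lambda>k m. cos (real k * (pi * mid_node M m))"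
        and F = "\<lambda>m n. f (mid_node M m, mid_node M n)", simplified mult_1_right,
        OF orthogonality_II[OF assms(1)] that]
    by (simp add: psi_II_def c_II_def cos_minus_eq power_divide mult.assoc)
  moreover have "psi_III M f (node M m, node M n) = f (node M m, node M n)"
    if "(m, n) \<in> strict_pairs (M - 1)" for m n
    \<comment> \<open>Dually to type II, type III weights only the nodes.\<close>
    using antisymmetric_interpolation[where N = "M - 1" and c = "2 / real M" and u = "\<lambda>m. dwt m M"
        and w = "\<lambda>_. 1" and \<phi> = "\<lambda>k m. cos ((real k + 1/2) * (pi * node M m))"
        and F = "\<lambda>m n. f (node M m, node M n)", simplified mult_1_left mult_1_right,
        OF orthogonality_III[OF assms(1)] that]
    by (simp add: psi_III_def c_III_def cos_minus_eq power_divide mult.assoc)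
  moreover have "psi_IV M f (mid_node M m, mid_node M n) = f (mid_node M m, mid_node M n)"
    if "(m, n) \<in> strict_pairs (M - 1)" for m n
    using antisymmetric_interpolation[where N = "M - 1" and c = "2 / real M" and u = "\<lambda>_. 1"
        and w = "\<lambda>_. 1" and \<phi> = "\<lambda>k m. cos ((real k + 1/2) * (pi * mid_node M m))"
        and F = "\<lambda>m n. f (mid_node M m, mid_node M n)", simplified mult_1_left mult_1_right,
        OF orthogonality_IV[OF assms(1)] that]
    by (simp add: psi_IV_def c_IV_def cos_minus_eq power_divide mult.assoc)
  ultimately show ?thesis by blast
qed

end
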